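(* $\displaystyle\lim_{n\to\infty} \frac{M(n)}{p(n)} = 0$.
   Context: $M(n)$ is the number of distinct values of the multinomial coefficients $n!/(\lambda_1!\cdots\lambda_r!)$ as $(\lambda_1,\dots,\lambda_r)$ ranges over all partitions of $n$; $p(n)$ is the number of partitions of $n$. *)

theory Defs
  imports "HOL-Analysis.Analysis" "HOL-Library.Multiset"
begin

definition partitions_of :: "nat \<Rightarrow> nat multiset set" where
  "partitions_of n = {P. 0 \<notin># P \<and> \<Sum>\<^sub># P = n}"

definition multinomial :: "nat \<Rightarrow> nat multiset \<Rightarrow> real" where
  "multinomial n P = fact n / (\<Prod>k\<in>#P. fact k)"

definition num_partitions :: "nat \<Rightarrow> nat" where
  "num_partitions n = card (partitions_of n)"

definition num_multinomials :: "nat \<Rightarrow> nat" where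
  "num_multinomials n = card (multinomial n ` partitions_of n)"

lemma finite_partitions_of: "finite (partitions_of n)"
proof -
  have "\<exists>xs. set xs \<subseteq> {..n} \<and> length xs \<le> n \<and> P = mset xs"
    if "P \<in> partitions_of n" for P
  proof -
    from that have 0: "0 \<notin># P" and s: "\<Sum>\<^sub># P = n"
      by (auto simp: partitions_of_def)
    have "k \<le> n" if "k \<in># P" for k
      using that s by (metis le_add1 multi_member_split sum_mset.add_mset)
    moreover have "size P \<le> \<Sum>\<^sub># P"
      using 0 by (induction P) auto
    moreover obtain xs where "P = mset xs"
      by (metis ex_mset)
    ultimately show ?thesis
      using s by (intro exI[of _ xs]) auto
  qed
  then have "partitions_of n \<subseteq> mset ` {xs. set xs \<subseteq> {..n} \<and> length xs \<le> n}"
    by blast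
  then show ?thesis
    using finite_lists_length_le[of "{..n}" n] by (blast intro: finite_subset)
qed

lemma num_partitions_pos: "num_partitions n > 0"
proof -
  have "(if n = 0 then {#} else {#n#}) \<in> partitions_of n"
    by (simp add: partitions_of_def)
  then show ?thesis
    using finite_partitions_of by (auto simp: num_partitions_def card_gt_0_iff)
qed

end

theory Submission
  imports Defs "HOL-Real_Asymp.Real_Asymp"
begin

text \<open>
  Since \<open>4! 1! 1! 1! = 3! 2! 2!\<close> and \<open>4 + 1 + 1 + 1 = 3 + 2 + 2\<close>, replacing the parts
  \<open>4, 1, 1, 1\<close> by \<open>3, 2, 2\<close> does not change the multinomial coefficient. Hence every value is
  attained at a partition that does not contain \<open>4, 1, 1, 1\<close>, and there are
  \<open>p(n) - p(n - 7)\<close> of these. It remains to see that \<open>p(n - 1) / p(n)\<close> tends to \<open>1\<close>, i.e. that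
  partitions without the part \<open>1\<close> are rare. Breaking one part \<open>s\<close> of such a partition into \<open>s\<close> ones
  is reversible, because the number of ones reveals \<open>s\<close>; so a partition without ones that has at
  least \<open>K\<close> different parts yields \<open>K\<close> partitions of its own. The partitions with at most \<open>K\<close>
  different parts are polynomially many, whereas \<open>p(n)\<close> grows faster than any polynomial.
\<close>

section \<open>Partitions containing or avoiding prescribed parts\<close>

lemma card_partitions_containing:
  assumes "0 \<notin># D"
  shows "card {P \<in> partitions_of (n + \<Sum>\<^sub># D). D \<subseteq># P} = num_partitions n"
proof -
  \<comment> \<open>Adding \<open>D\<close> is injective and is undone by removing \<open>D\<close>;
    no zero part enters because \<open>0 \<notin># D\<close>.\<close>
  have "{P \<in> partitions_of (n + \<Sum>\<^sub># D). D \<subseteq># P} = (\<lambda>P. P + D) ` partitions_of n"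
  proof (intro subset_antisym subsetI)
    fix P assume "P \<in> {P \<in> partitions_of (n + \<Sum>\<^sub># D). D \<subseteq># P}"
    then have P: "0 \<notin># P" "\<Sum>\<^sub># P = n + \<Sum>\<^sub># D" and "D \<subseteq># P"
      by (auto simp: partitions_of_def)
    from \<open>D \<subseteq># P\<close> obtain R where "P = R + D"
      by (metis subset_mset.diff_add)
    with P show "P \<in> (\<lambda>P. P + D) ` partitions_of n"
      by (auto simp: partitions_of_def)
  qed (use assms in \<open>auto simp: partitions_of_def\<close>)
  then show ?thesis
    by (simp add: num_partitions_def card_image)
qed

lemma card_partitions_avoiding:
  assumes "0 \<notin># D"
  shows "card {P \<in> partitions_of (n + \<Sum>\<^sub># D). \<not> D \<subseteq># P} + num_partitions n
    = num_partitions (n + \<Sum>\<^sub># D)"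
proof -
  let ?S = "partitions_of (n + \<Sum>\<^sub># D)"
  have "card ({P \<in> ?S. \<not> D \<subseteq># P} \<union> {P \<in> ?S. D \<subseteq># P})
      = card {P \<in> ?S. \<not> D \<subseteq># P} + card {P \<in> ?S. D \<subseteq># P}"
    by (rule card_Un_disjoint) (auto simp: finite_partitions_of)
  moreover have "{P \<in> ?S. \<not> D \<subseteq># P} \<union> {P \<in> ?S. D \<subseteq># P} = ?S"
    by blast
  ultimately show ?thesis
    by (simp add: card_partitions_containing[OF assms] num_partitions_def)
qed

section \<open>Partitions with few different parts\<close>

text \<open>A nonempty multiset is determined by one part, its multiplicity and the rest, which has
  one different part fewer; so each induction step costs a factor \<open>(n + 1) ^ 2\<close>. The
  sets \<open>S K\<close> bound parts and multiplicities instead of fixing the sum, since removing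
  all copies of a part preserves these bounds but can change the sum.\<close>

lemma card_few_distinct_parts:
  fixes n K :: nat
  defines "S \<equiv> \<lambda>K. {P :: nat multiset. set_mset P \<subseteq> {..n} \<and> (\<forall>x. count P x \<le> n)
    \<and> card (set_mset P) \<le> K}"
  shows "finite (S K) \<and> card (S K) \<le> (n + 1) ^ (2 * K)"
proof (induction K)
  case 0
  have "S 0 = {{#}}"
    by (auto simp: S_def)
  then show ?case
    by simp
next
  case (Suc K)
  let ?f = "\<lambda>(P, s, m). P + replicate_mset m s"
  let ?D = "S K \<times> {..n} \<times> {..n}"
  have sub: "S (Suc K) \<subseteq> ?f ` ?D"
  proof
    fix P assume P: "P \<in> S (Suc K)"
    show "P \<in> ?f ` ?D"
    proof (cases "P = {#}")
      case True
      then show ?thesis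
        by (intro image_eqI[of _ _ "({#}, 0, 0)"]) (auto simp: S_def)
    next
      case False
      then obtain s where s: "s \<in># P"
        by blast
      define R where "R = {#x \<in># P. x \<noteq> s#}"
      have "P = R + replicate_mset (count P s) s"
        by (auto simp: R_def multiset_eq_iff)
      moreover have "set_mset R = set_mset P - {s}"
        by (auto simp: R_def)
      then have "R \<in> S K"
        using P s by (auto simp: S_def R_def)
      ultimately show ?thesis
        using P s by (intro image_eqI[of _ _ "(R, s, count P s)"]) (auto simp: S_def)
    qed
  qed
  have fin: "finite ?D"
    using Suc by simp
  have "card (S (Suc K)) \<le> card ?D"
    using sub fin by (meson card_image_le card_mono finite_imageI le_trans)
  also have "\<dots> = card (S K) * (n + 1) ^ 2"
    by (simp add: card_cartesian_product power2_eq_square)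
  also have "\<dots> \<le> (n + 1) ^ (2 * K) * (n + 1) ^ 2"
    using Suc by (intro mult_right_mono) auto
  also have "\<dots> = (n + 1) ^ (2 * Suc K)"
    by (simp add: power_add[symmetric])
  finally show ?case
    using sub fin finite_subset by blast
qed

lemma count_le_sum_mset:
  fixes P :: "nat multiset"
  assumes "0 \<notin># P"
  shows "count P x \<le> \<Sum>\<^sub># P"
  using assms by (induction P) auto

lemma card_partitions_few_distinct_parts:
  "card {P \<in> partitions_of n. card (set_mset P) \<le> K} \<le> (n + 1) ^ (2 * K)"
proof -
  have "{P \<in> partitions_of n. card (set_mset P) \<le> K} \<subseteq>
      {P. set_mset P \<subseteq> {..n} \<and> (\<forall>x. count P x \<le> n) \<and> card (set_mset P) \<le> K}"
    by (auto simp: partitions_of_def count_le_sum_mset dest: multi_member_split)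
  then show ?thesis
    using card_few_distinct_parts[of n K] by (meson card_mono le_trans)
qed

section \<open>Superpolynomial growth of p(n)\<close>

lemma num_partitions_ge_power:
  assumes "t * t \<le> n"
  shows "2 ^ (t - 1) \<le> num_partitions n"
proof -
  \<comment> \<open>A set of different parts between 2 and \<open>t\<close> has sum at most
    \<open>t * t\<close>, so it can be filled up to \<open>n\<close> with ones. Deleting the ones
    recovers the set.\<close>
  let ?f = "\<lambda>A. mset_set A + replicate_mset (n - \<Sum>A) (1::nat)"
  have "inj_on ?f (Pow {2..t})"
  proof (rule inj_onI)
    fix A B assume AB: "A \<in> Pow {2..t}" "B \<in> Pow {2..t}" and eq: "?f A = ?f B"
    have filt: "{#x \<in># ?f C. x \<noteq> 1#} = mset_set C" if "C \<in> Pow {2..t}" for C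
      using that by (force simp: multiset_eq_iff count_mset_set')
    have "mset_set A = mset_set B"
      using filt[OF AB(1)] filt[OF AB(2)] eq by metis
    then show "A = B"
      using AB by (metis PowD finite_atLeastAtMost finite_set_mset_mset_set finite_subset)
  qed
  moreover have "?f ` Pow {2..t} \<subseteq> partitions_of n"
  proof clarify
    fix A assume A: "A \<subseteq> {2..t}"
    then have fin: "finite A"
      by (meson finite_atLeastAtMost finite_subset)
    have "\<Sum>A \<le> \<Sum>{2..t}"
      using A by (intro sum_mono2) auto
    also have "\<dots> \<le> card {2..t} * t"
      using sum_bounded_above[of "{2..t}" "\<lambda>x. x" t] by simp
    also have "\<dots> \<le> t * t"
      by (intro mult_right_mono) auto
    finally have "\<Sum>A \<le> n"
      using assms by simp
    moreover have "\<Sum>\<^sub># (mset_set A) = \<Sum>A"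
      by (simp add: sum_unfold_sum_mset)
    ultimately show "?f A \<in> partitions_of n"
      using A fin by (auto simp: partitions_of_def)
  qed
  ultimately have "card (Pow {2..t}) \<le> card (partitions_of n)"
    by (intro card_inj_on_le finite_partitions_of)
  then show ?thesis
    by (simp add: card_Pow num_partitions_def)
qed

lemma num_partitions_ge_powr: "2 powr (sqrt (real n) - 2) \<le> real (num_partitions n)"
proof -
  define t where "t = nat \<lfloor>sqrt (real n)\<rfloor>"
  have "real t \<le> sqrt (real n)"
    by (simp add: t_def)
  then have "real t * real t \<le> sqrt (real n) * sqrt (real n)"
    by (intro mult_mono) auto
  then have "real (t * t) \<le> real n"
    by simp
  then have "2 ^ (t - 1) \<le> num_partitions n"
    by (intro num_partitions_ge_power) linarith
  \<comment> \<open>The 2 pays for rounding down to \<open>t\<close> and for the 1 subtracted from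
    \<open>t\<close>; if \<open>t = 0\<close>, the truncated \<open>t - 1\<close> is only
    larger.\<close>
  have "2 powr (sqrt (real n) - 2) \<le> 2 powr real (t - 1)"
    unfolding t_def by (intro powr_mono) linarith+
  also have "\<dots> = real (2 ^ (t - 1))"
    by (simp add: powr_realpow)
  also have "\<dots> \<le> real (num_partitions n)"
    using \<open>2 ^ (t - 1) \<le> num_partitions n\<close> by (rule of_nat_mono)
  finally show ?thesis .
qed

lemma polynomial_over_num_partitions_tendsto_0:
  "(\<lambda>n. real ((n + 1) ^ k) / real (num_partitions n)) \<longlonglongrightarrow> 0"
proof (rule tendsto_sandwich[OF _ _ tendsto_const])
  show "(\<lambda>n. (real n + 1) ^ k / 2 powr (sqrt (real n) - 2)) \<longlonglongrightarrow> 0"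
    by real_asymp
  show "\<forall>\<^sub>F n in sequentially. real ((n + 1) ^ k) / real (num_partitions n)
      \<le> (real n + 1) ^ k / 2 powr (sqrt (real n) - 2)"
    by (intro always_eventually allI)
      (auto intro!: divide_left_mono num_partitions_ge_powr mult_pos_pos
        simp: num_partitions_pos add.commute)
qed auto

section \<open>Rarity of partitions without ones\<close>

lemma card_partitions_without_1_many_distinct_parts:
  "K * card {P \<in> partitions_of n. 1 \<notin># P \<and> K \<le> card (set_mset P)} \<le> num_partitions n"
proof -
  define Q where "Q = {P \<in> partitions_of n. 1 \<notin># P \<and> K \<le> card (set_mset P)}"
  let ?f = "\<lambda>(P, s). P - {#s#} + replicate_mset s (1::nat)"
  have "finite Q"
    by (simp add: Q_def finite_partitions_of)
  \<comment> \<open>Count the pairs of a partition in \<open>Q\<close> and one of its different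
    parts.\<close>
  have "K * card Q \<le> (\<Sum>P\<in>Q. card (set_mset P))"
    using sum_bounded_below[of Q K "\<lambda>P. card (set_mset P)"] by (simp add: Q_def mult.commute)
  also have "\<dots> = card (SIGMA P:Q. set_mset P)"
    using \<open>finite Q\<close> by simp
  also have "\<dots> \<le> card (partitions_of n)"
  proof (intro card_inj_on_le finite_partitions_of)
    show "inj_on ?f (SIGMA P:Q. set_mset P)"
    proof (intro inj_onI; clarify)
      fix P s P' s'
      assume P: "P \<in> Q" "s \<in># P" and P': "P' \<in> Q" "s' \<in># P'"
        and eq: "P - {#s#} + replicate_mset s 1 = P' - {#s'#} + replicate_mset s' 1"
      \<comment> \<open>Members of \<open>Q\<close> have no ones, so all ones in the image come from
        the broken part and their number is its size. Cancelling them and putting the part back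
        recovers the partition.\<close>
      have ones: "count (R - {#r#} + replicate_mset r 1) 1 = r" if "R \<in> Q" for R r
        using that by (simp add: Q_def not_in_iff)
      have "s = s'"
        using ones[OF P(1), of s] ones[OF P'(1), of s'] eq by metis
      with eq P P' show "P = P' \<and> s = s'"
        by (metis add_right_cancel insert_DiffM)
    qed
    show "?f ` (SIGMA P:Q. set_mset P) \<subseteq> partitions_of n"
    proof clarify
      fix P s assume P: "P \<in> Q" "s \<in># P"
      from P(2) obtain R where "P = add_mset s R"
        by (rule mset_add)
      with P show "P - {#s#} + replicate_mset s 1 \<in> partitions_of n"
        by (simp add: Q_def partitions_of_def)
    qed
  qed
  finally show ?thesis
    by (simp add: Q_def num_partitions_def)
qed

text \<open>Union bound over at least \<open>K\<close> and at most \<open>K\<close> different parts;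
  counting those with exactly \<open>K\<close> twice does no harm.\<close>

lemma card_partitions_without_1_le:
  "K * card {P \<in> partitions_of n. 1 \<notin># P} \<le> num_partitions n + K * (n + 1) ^ (2 * K)"
proof -
  have "card {P \<in> partitions_of n. 1 \<notin># P} \<le>
      card ({P \<in> partitions_of n. 1 \<notin># P \<and> K \<le> card (set_mset P)} \<union>
        {P \<in> partitions_of n. card (set_mset P) \<le> K})"
    by (intro card_mono) (auto simp: finite_partitions_of)
  also have "\<dots> \<le> card {P \<in> partitions_of n. 1 \<notin># P \<and> K \<le> card (set_mset P)} + (n + 1) ^ (2 * K)"
    by (rule order.trans[OF card_Un_le add_left_mono[OF card_partitions_few_distinct_parts]])
  finally have "K * card {P \<in> partitions_of n. 1 \<notin># P} \<le>
      K * (card {P \<in> partitions_of n. 1 \<notin># P \<and> K \<le> card (set_mset P)} + (n + 1) ^ (2 * K))"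
    by (rule mult_le_mono2)
  also have "\<dots> \<le> num_partitions n + K * (n + 1) ^ (2 * K)"
    unfolding add_mult_distrib2
    by (rule add_right_mono[OF card_partitions_without_1_many_distinct_parts])
  finally show ?thesis .
qed

lemma partitions_without_1_rare:
  "(\<lambda>n. real (card {P \<in> partitions_of n. 1 \<notin># P}) / real (num_partitions n)) \<longlonglongrightarrow> 0"
proof (rule order_tendstoI)
  fix e :: real assume "0 < e"
  \<comment> \<open>\<open>K\<close> is chosen before \<open>n\<close>, so the exponent
    \<open>2 * K\<close> below is constant and the polynomial term eventually takes only the other
    half of \<open>e\<close>.\<close>
  obtain K :: nat where K: "0 < K" "1 / real K < e / 2"
    using \<open>0 < e\<close> nat_approx_posE[of "e / 2"]
    by (metis half_gt_zero zero_less_Suc)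
  have "\<forall>\<^sub>F n in sequentially. real ((n + 1) ^ (2 * K)) / real (num_partitions n) < e / 2"
    using \<open>0 < e\<close> by (intro order_tendstoD[OF polynomial_over_num_partitions_tendsto_0]) simp
  then show "\<forall>\<^sub>F n in sequentially.
      real (card {P \<in> partitions_of n. 1 \<notin># P}) / real (num_partitions n) < e"
  proof eventually_elim
    case (elim n)
    let ?q = "real (card {P \<in> partitions_of n. 1 \<notin># P})" and ?p = "real (num_partitions n)"
    have "real K * ?q \<le> ?p + real K * real ((n + 1) ^ (2 * K))"
      using of_nat_mono[OF card_partitions_without_1_le[of K n], where 'a = real]
      unfolding of_nat_add of_nat_mult .
    then have "?q / ?p \<le> 1 / real K + real ((n + 1) ^ (2 * K)) / ?p"
      using K(1) num_partitions_pos[of n] by (simp add: field_simps)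
    with elim K(2) show ?case
      by linarith
  qed
qed (auto intro!: always_eventually less_le_trans[of _ 0])

text \<open>The ratio is a product of \<open>k\<close> ratios of consecutive values. Each of these
  is 1 minus the proportion of partitions without ones, because removing a one leaves an arbitrary
  partition of the preceding number.\<close>

lemma num_partitions_ratio_tendsto_1:
  "(\<lambda>n. real (num_partitions n) / real (num_partitions (n + k))) \<longlonglongrightarrow> 1"
proof (induction k)
  case 0
  then show ?case
    by (simp add: num_partitions_pos less_imp_neq[symmetric])
next
  case (Suc k)
  let ?q = "\<lambda>n. real (card {P \<in> partitions_of n. 1 \<notin># P})"
  have "real (num_partitions n) / real (num_partitions (Suc n)) =
      1 - ?q (Suc n) / real (num_partitions (Suc n))" for n
  proof -
    have "?q (Suc n) + real (num_partitions n) = real (num_partitions (Suc n))"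
      using card_partitions_avoiding[of "{#1#}" n]
      by (simp flip: of_nat_add)
    then show ?thesis
      using num_partitions_pos[of "Suc n"] by (simp add: field_simps)
  qed
  moreover have "(\<lambda>n. 1 - ?q (Suc n) / real (num_partitions (Suc n))) \<longlonglongrightarrow> 1 - 0"
    by (intro tendsto_diff tendsto_const LIMSEQ_Suc partitions_without_1_rare)
  ultimately have "(\<lambda>n. real (num_partitions n) / real (num_partitions (Suc n))) \<longlonglongrightarrow> 1"
    by simp
  then have "(\<lambda>n. real (num_partitions (n + k)) / real (num_partitions (Suc (n + k)))) \<longlonglongrightarrow> 1"
    by (rule LIMSEQ_ignore_initial_segment)
  from tendsto_mult[OF Suc this] show ?case
    by (simp add: num_partitions_pos less_imp_neq[symmetric])
qed

section \<open>Coinciding multinomial coefficients\<close>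

text \<open>Replacing 4, 1, 1, 1 by 3, 2, 2 can be repeated only finitely often, since each
  replacement lowers the number of fours.\<close>

lemma num_multinomials_le:
  "num_multinomials n \<le> card {P \<in> partitions_of n. \<not> {#4, 1, 1, 1#} \<subseteq># P}"
proof -
  have "\<exists>R \<in> partitions_of n. \<not> {#4, 1, 1, 1#} \<subseteq># R \<and> multinomial n R = multinomial n P"
    if "P \<in> partitions_of n" for P
    using that
  proof (induction "count P 4" arbitrary: P rule: less_induct)
    case less
    show ?case
    proof (cases "{#4, 1, 1, 1#} \<subseteq># P")
      case True
      then obtain U where U: "P = U + {#4, 1, 1, 1#}"
        by (metis subset_mset.diff_add)
      let ?P' = "U + {#3, 2, 2#}"
      have "?P' \<in> partitions_of n"
        using less.prems by (auto simp: U partitions_of_def)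
      moreover have "multinomial n ?P' = multinomial n P"
        by (simp add: U multinomial_def fact_numeral)
      moreover have "count ?P' 4 < count P 4"
        by (simp add: U)
      ultimately show ?thesis
        using less.hyps by metis
    qed (use less.prems in blast)
  qed
  then have "multinomial n ` partitions_of n \<subseteq>
      multinomial n ` {P \<in> partitions_of n. \<not> {#4, 1, 1, 1#} \<subseteq># P}"
    by (force simp: image_iff)
  then show ?thesis
    unfolding num_multinomials_def
    by (rule surj_card_le[rotated]) (simp add: finite_partitions_of)
qed

theorem theorem8:
  shows "(\<lambda>n. real (num_multinomials n) / real (num_partitions n)) \<longlonglongrightarrow> 0"
proof (rule LIMSEQ_offset[of _ 7], rule tendsto_sandwich[OF _ _ tendsto_const])
  \<comment> \<open>The shift by 7 = 4 + 1 + 1 + 1 avoids the truncated difference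
    \<open>n - 7\<close>.\<close>
  show "(\<lambda>n. 1 - real (num_partitions n) / real (num_partitions (n + 7))) \<longlonglongrightarrow> 0"
    using tendsto_diff[OF tendsto_const num_partitions_ratio_tendsto_1, of 1 7] by simp
  have "real (num_multinomials (n + 7)) / real (num_partitions (n + 7))
      \<le> 1 - real (num_partitions n) / real (num_partitions (n + 7))" for n
  proof -
    have "num_multinomials (n + 7) + num_partitions n \<le> num_partitions (n + 7)"
      using num_multinomials_le[of "n + 7"] card_partitions_avoiding[of "{#4, 1, 1, 1#}" n]
      by simp
    then have "real (num_multinomials (n + 7)) + real (num_partitions n)
        \<le> real (num_partitions (n + 7))"
      by linarith
    then show ?thesis
      using num_partitions_pos[of "n + 7"] by (simp add: field_simps)
  qed
  then show "\<forall>\<^sub>F n in sequentially. real (num_multinomials (n + 7)) / real (num_partitions (n + 7))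
      \<le> 1 - real (num_partitions n) / real (num_partitions (n + 7))"
    by simp
qed auto

end
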